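(* The following data define a lax symmetric monoidal functor $(\mathsf{Opt},\varphi)\colon (\mathbf{FinSet},+)\to(\mathbf{Set},\times)$. (i) On objects, $\mathsf{Opt}$ takes a finite set $N$ to the set $\{f\colon\mathbb{R}^N\to\mathbb{R}\mid f\in C^1\}$. (ii) On morphisms, $\mathsf{Opt}$ takes a function $\phi\colon N\to M$ to the function $\mathsf{Opt}(\phi)\colon\mathsf{Opt}(N)\to\mathsf{Opt}(M)$, $f\mapsto f\circ\phi^*$. (iii) For finite sets $N,M$, the product comparison $\varphi_{N,M}\colon\mathsf{Opt}(N)\times\mathsf{Opt}(M)\to\mathsf{Opt}(N+M)$ is given by $\varphi_{N,M}(f,g)(z)=f(\iota_N^*(z))+g(\iota_M^*(z))$ for all $z\in\mathbb{R}^{N+M}$. (iv) The unit comparison $\varphi_0\colon\{*\}\to\mathsf{Opt}(\emptyset)$ picks out the zero function $\mathbb{R}^0\to\mathbb{R}$, $0\mapsto 0$.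
   Context: $(\mathbf{FinSet},+)$ is the category of finite sets and functions with the symmetric monoidal structure given by disjoint union (unit $\emptyset$); $(\mathbf{Set},\times)$ is sets with Cartesian product (unit $\{*\}$). A lax symmetric monoidal functor is a functor with a natural product comparison and a unit comparison satisfying the usual associativity, unitality and symmetry axioms; the paper calls such functors $(\mathbf{FinSet},+)\to(\mathbf{Set},\times)$ "finset algebras". For a finite set $N$, $\mathbb{R}^N$ is the vector space of functions $N\to\mathbb{R}$. For a function $\phi\colon N\to M$ of finite sets, the pullback $\phi^*\colon\mathbb{R}^M\to\mathbb{R}^N$ is the linear map $\phi^*(y)_i=y_{\phi(i)}$. The maps $\iota_N\colon N\to N+M$ and $\iota_M\colon M\to N+M$ are the inclusions into the disjoint union. $C^1$ means once continuously differentiable. *)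

theory Defs
  imports "HOL-Analysis.Analysis"
begin

section \<open>Symmetric monoidal categories and lax symmetric monoidal functors\<close>

record ('o, 'm) cat =
  Obj :: "'o set"
  Hom :: "'o \<Rightarrow> 'o \<Rightarrow> 'm set"
  Idm :: "'o \<Rightarrow> 'm"
  Comp :: "'m \<Rightarrow> 'm \<Rightarrow> 'm"  (infixl "\<odot>\<index>" 70)

locale category =
  fixes C :: "('o, 'm, 'z) cat_scheme" (structure)
  assumes Hom_disjoint:
      "\<lbrakk>X \<in> Obj C; Y \<in> Obj C; X' \<in> Obj C; Y' \<in> Obj C; f \<in> Hom C X Y; f \<in> Hom C X' Y'\<rbrakk>
        \<Longrightarrow> X = X' \<and> Y = Y'"
    and Id_in_Hom: "X \<in> Obj C \<Longrightarrow> Idm C X \<in> Hom C X X"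
    and Comp_in_Hom:
      "\<lbrakk>X \<in> Obj C; Y \<in> Obj C; Z \<in> Obj C; f \<in> Hom C X Y; g \<in> Hom C Y Z\<rbrakk>
        \<Longrightarrow> g \<odot> f \<in> Hom C X Z"
    and Comp_Id: "\<lbrakk>X \<in> Obj C; Y \<in> Obj C; f \<in> Hom C X Y\<rbrakk> \<Longrightarrow> f \<odot> Idm C X = f"
    and Id_Comp: "\<lbrakk>X \<in> Obj C; Y \<in> Obj C; f \<in> Hom C X Y\<rbrakk> \<Longrightarrow> Idm C Y \<odot> f = f"
    and Comp_assoc:
      "\<lbrakk>X \<in> Obj C; Y \<in> Obj C; Z \<in> Obj C; W \<in> Obj C;
        f \<in> Hom C X Y; g \<in> Hom C Y Z; h \<in> Hom C Z W\<rbrakk>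
        \<Longrightarrow> (h \<odot> g) \<odot> f = h \<odot> (g \<odot> f)"

definition iso_in :: "('o, 'm, 'z) cat_scheme \<Rightarrow> 'o \<Rightarrow> 'o \<Rightarrow> 'm \<Rightarrow> bool" where
  "iso_in C X Y f \<longleftrightarrow>
     f \<in> Hom C X Y \<and> (\<exists>g\<in>Hom C Y X. Comp C g f = Idm C X \<and> Comp C f g = Idm C Y)"

record ('o, 'm) smcat = "('o, 'm) cat" +
  tens :: "'o \<Rightarrow> 'o \<Rightarrow> 'o"  (infixr "\<otimes>\<index>" 75)
  tensm :: "'m \<Rightarrow> 'm \<Rightarrow> 'm"  (infixr "\<boxtimes>\<index>" 75)
  unit_obj :: "'o"  ("\<one>\<index>")
  assoc :: "'o \<Rightarrow> 'o \<Rightarrow> 'o \<Rightarrow> 'm"  ("\<alpha>\<index>")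
  lunit :: "'o \<Rightarrow> 'm"  ("\<lambda>l\<index>")
  runit :: "'o \<Rightarrow> 'm"  ("\<rho>\<index>")
  braid :: "'o \<Rightarrow> 'o \<Rightarrow> 'm"  ("\<sigma>\<index>")

locale symmetric_monoidal_category = category C
  for C :: "('o, 'm, 'z) smcat_scheme" (structure) +
  assumes tens_in_Obj: "\<lbrakk>X \<in> Obj C; Y \<in> Obj C\<rbrakk> \<Longrightarrow> X \<otimes> Y \<in> Obj C"
    and unit_in_Obj: "\<one> \<in> Obj C"
    and tensm_in_Hom:
      "\<lbrakk>X \<in> Obj C; Y \<in> Obj C; X' \<in> Obj C; Y' \<in> Obj C; f \<in> Hom C X Y; f' \<in> Hom C X' Y'\<rbrakk>
        \<Longrightarrow> f \<boxtimes> f' \<in> Hom C (X \<otimes> X') (Y \<otimes> Y')"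
    and tensm_Id: "\<lbrakk>X \<in> Obj C; Y \<in> Obj C\<rbrakk> \<Longrightarrow> Idm C X \<boxtimes> Idm C Y = Idm C (X \<otimes> Y)"
    and tensm_Comp:
      "\<lbrakk>X \<in> Obj C; Y \<in> Obj C; Z \<in> Obj C; X' \<in> Obj C; Y' \<in> Obj C; Z' \<in> Obj C;
        f \<in> Hom C X Y; g \<in> Hom C Y Z; f' \<in> Hom C X' Y'; g' \<in> Hom C Y' Z'\<rbrakk>
        \<Longrightarrow> (g \<odot> f) \<boxtimes> (g' \<odot> f') = (g \<boxtimes> g') \<odot> (f \<boxtimes> f')"
    and assoc_iso: "\<lbrakk>X \<in> Obj C; Y \<in> Obj C; Z \<in> Obj C\<rbrakk>
        \<Longrightarrow> iso_in C ((X \<otimes> Y) \<otimes> Z) (X \<otimes> (Y \<otimes> Z)) (\<alpha> X Y Z)"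
    and lunit_iso: "X \<in> Obj C \<Longrightarrow> iso_in C (\<one> \<otimes> X) X (\<lambda>l X)"
    and runit_iso: "X \<in> Obj C \<Longrightarrow> iso_in C (X \<otimes> \<one>) X (\<rho> X)"
    and braid_iso: "\<lbrakk>X \<in> Obj C; Y \<in> Obj C\<rbrakk> \<Longrightarrow> iso_in C (X \<otimes> Y) (Y \<otimes> X) (\<sigma> X Y)"
    and assoc_natural:
      "\<lbrakk>X \<in> Obj C; Y \<in> Obj C; Z \<in> Obj C; X' \<in> Obj C; Y' \<in> Obj C; Z' \<in> Obj C;
        f \<in> Hom C X X'; g \<in> Hom C Y Y'; h \<in> Hom C Z Z'\<rbrakk>
        \<Longrightarrow> \<alpha> X' Y' Z' \<odot> ((f \<boxtimes> g) \<boxtimes> h) = (f \<boxtimes> (g \<boxtimes> h)) \<odot> \<alpha> X Y Z"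
    and lunit_natural: "\<lbrakk>X \<in> Obj C; Y \<in> Obj C; f \<in> Hom C X Y\<rbrakk>
        \<Longrightarrow> \<lambda>l Y \<odot> (Idm C \<one> \<boxtimes> f) = f \<odot> \<lambda>l X"
    and runit_natural: "\<lbrakk>X \<in> Obj C; Y \<in> Obj C; f \<in> Hom C X Y\<rbrakk>
        \<Longrightarrow> \<rho> Y \<odot> (f \<boxtimes> Idm C \<one>) = f \<odot> \<rho> X"
    and braid_natural:
      "\<lbrakk>X \<in> Obj C; Y \<in> Obj C; X' \<in> Obj C; Y' \<in> Obj C; f \<in> Hom C X X'; g \<in> Hom C Y Y'\<rbrakk>
        \<Longrightarrow> \<sigma> X' Y' \<odot> (f \<boxtimes> g) = (g \<boxtimes> f) \<odot> \<sigma> X Y"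
    and pentagon:
      "\<lbrakk>X \<in> Obj C; Y \<in> Obj C; Z \<in> Obj C; W \<in> Obj C\<rbrakk>
        \<Longrightarrow> \<alpha> X Y (Z \<otimes> W) \<odot> \<alpha> (X \<otimes> Y) Z W
          = (Idm C X \<boxtimes> \<alpha> Y Z W) \<odot> \<alpha> X (Y \<otimes> Z) W \<odot> (\<alpha> X Y Z \<boxtimes> Idm C W)"
    and triangle:
      "\<lbrakk>X \<in> Obj C; Y \<in> Obj C\<rbrakk> \<Longrightarrow> (Idm C X \<boxtimes> \<lambda>l Y) \<odot> \<alpha> X \<one> Y = \<rho> X \<boxtimes> Idm C Y"
    and hexagon:
      "\<lbrakk>X \<in> Obj C; Y \<in> Obj C; Z \<in> Obj C\<rbrakk>
        \<Longrightarrow> \<alpha> Y Z X \<odot> \<sigma> X (Y \<otimes> Z) \<odot> \<alpha> X Y Z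
          = (Idm C Y \<boxtimes> \<sigma> X Z) \<odot> \<alpha> Y X Z \<odot> (\<sigma> X Y \<boxtimes> Idm C Z)"
    and braid_symmetric: "\<lbrakk>X \<in> Obj C; Y \<in> Obj C\<rbrakk> \<Longrightarrow> \<sigma> Y X \<odot> \<sigma> X Y = Idm C (X \<otimes> Y)"

locale lax_symmetric_monoidal_functor =
  C: symmetric_monoidal_category C + D: symmetric_monoidal_category D
  for C :: "('o, 'm, 'z) smcat_scheme" (structure)
    and D :: "('p, 'n, 'y) smcat_scheme" (structure) +
  fixes F\<^sub>o :: "'o \<Rightarrow> 'p"
    and F\<^sub>m :: "'m \<Rightarrow> 'n"
    and \<mu> :: "'o \<Rightarrow> 'o \<Rightarrow> 'n"
    and \<epsilon> :: "'n"
  assumes F_in_Obj: "X \<in> Obj C \<Longrightarrow> F\<^sub>o X \<in> Obj D"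
    and F_in_Hom: "\<lbrakk>X \<in> Obj C; Y \<in> Obj C; f \<in> Hom C X Y\<rbrakk> \<Longrightarrow> F\<^sub>m f \<in> Hom D (F\<^sub>o X) (F\<^sub>o Y)"
    and F_Id: "X \<in> Obj C \<Longrightarrow> F\<^sub>m (Idm C X) = Idm D (F\<^sub>o X)"
    and F_Comp:
      "\<lbrakk>X \<in> Obj C; Y \<in> Obj C; Z \<in> Obj C; f \<in> Hom C X Y; g \<in> Hom C Y Z\<rbrakk>
        \<Longrightarrow> F\<^sub>m (g \<odot>\<^bsub>C\<^esub> f) = F\<^sub>m g \<odot>\<^bsub>D\<^esub> F\<^sub>m f"
    and \<mu>_in_Hom: "\<lbrakk>X \<in> Obj C; Y \<in> Obj C\<rbrakk>
        \<Longrightarrow> \<mu> X Y \<in> Hom D (F\<^sub>o X \<otimes>\<^bsub>D\<^esub> F\<^sub>o Y) (F\<^sub>o (X \<otimes>\<^bsub>C\<^esub> Y))"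
    and \<epsilon>_in_Hom: "\<epsilon> \<in> Hom D \<one>\<^bsub>D\<^esub> (F\<^sub>o \<one>\<^bsub>C\<^esub>)"
    and \<mu>_natural:
      "\<lbrakk>X \<in> Obj C; Y \<in> Obj C; X' \<in> Obj C; Y' \<in> Obj C; f \<in> Hom C X X'; g \<in> Hom C Y Y'\<rbrakk>
        \<Longrightarrow> \<mu> X' Y' \<odot>\<^bsub>D\<^esub> (F\<^sub>m f \<boxtimes>\<^bsub>D\<^esub> F\<^sub>m g) = F\<^sub>m (f \<boxtimes>\<^bsub>C\<^esub> g) \<odot>\<^bsub>D\<^esub> \<mu> X Y"
    and \<mu>_associative:
      "\<lbrakk>X \<in> Obj C; Y \<in> Obj C; Z \<in> Obj C\<rbrakk>
        \<Longrightarrow> F\<^sub>m (\<alpha>\<^bsub>C\<^esub> X Y Z) \<odot>\<^bsub>D\<^esub> \<mu> (X \<otimes>\<^bsub>C\<^esub> Y) Z \<odot>\<^bsub>D\<^esub> (\<mu> X Y \<boxtimes>\<^bsub>D\<^esub> Idm D (F\<^sub>o Z))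
          = \<mu> X (Y \<otimes>\<^bsub>C\<^esub> Z) \<odot>\<^bsub>D\<^esub> (Idm D (F\<^sub>o X) \<boxtimes>\<^bsub>D\<^esub> \<mu> Y Z) \<odot>\<^bsub>D\<^esub> \<alpha>\<^bsub>D\<^esub> (F\<^sub>o X) (F\<^sub>o Y) (F\<^sub>o Z)"
    and left_unital:
      "X \<in> Obj C \<Longrightarrow>
        F\<^sub>m (\<lambda>l\<^bsub>C\<^esub> X) \<odot>\<^bsub>D\<^esub> \<mu> \<one>\<^bsub>C\<^esub> X \<odot>\<^bsub>D\<^esub> (\<epsilon> \<boxtimes>\<^bsub>D\<^esub> Idm D (F\<^sub>o X)) = \<lambda>l\<^bsub>D\<^esub> (F\<^sub>o X)"
    and right_unital:
      "X \<in> Obj C \<Longrightarrow>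
        F\<^sub>m (\<rho>\<^bsub>C\<^esub> X) \<odot>\<^bsub>D\<^esub> \<mu> X \<one>\<^bsub>C\<^esub> \<odot>\<^bsub>D\<^esub> (Idm D (F\<^sub>o X) \<boxtimes>\<^bsub>D\<^esub> \<epsilon>) = \<rho>\<^bsub>D\<^esub> (F\<^sub>o X)"
    and \<mu>_symmetric:
      "\<lbrakk>X \<in> Obj C; Y \<in> Obj C\<rbrakk>
        \<Longrightarrow> F\<^sub>m (\<sigma>\<^bsub>C\<^esub> X Y) \<odot>\<^bsub>D\<^esub> \<mu> X Y = \<mu> Y X \<odot>\<^bsub>D\<^esub> \<sigma>\<^bsub>D\<^esub> (F\<^sub>o X) (F\<^sub>o Y)"


section \<open>Functions between sets\<close>

text \<open>A function between subsets of a fixed type, carrying its domain and codomain. In the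
  canonical form built by \<open>arr\<close> the underlying function is \<open>undefined\<close> off the domain, so that
  equality of arrows is equality of functions of sets.\<close>

datatype 'x arrow = Arrow (Dom: "'x set") (Fun: "'x \<Rightarrow> 'x") (Cod: "'x set")

definition arr :: "'x set \<Rightarrow> ('x \<Rightarrow> 'x) \<Rightarrow> 'x set \<Rightarrow> 'x arrow" where
  "arr A f B = Arrow A (restrict f A) B"

definition arrows :: "'x set \<Rightarrow> 'x set \<Rightarrow> 'x arrow set" where
  "arrows A B = {Arrow A f B | f. f \<in> A \<rightarrow>\<^sub>E B}"

definition arrow_comp :: "'x arrow \<Rightarrow> 'x arrow \<Rightarrow> 'x arrow" where
  "arrow_comp g f = arr (Dom f) (Fun g \<circ> Fun f) (Cod g)"


section \<open>Finite sets with disjoint union\<close>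

text \<open>A universe of elements that contains the (arbitrary) type \<open>'a\<close> and is closed under
  tagging: the finite subsets of \<open>'a elt\<close> include a copy of every finite subset of \<open>'a\<close> and are
  closed under disjoint union.\<close>

datatype 'a elt = Elt 'a | InL "'a elt" | InR "'a elt"

definition dunion :: "'a elt set \<Rightarrow> 'a elt set \<Rightarrow> 'a elt set" where
  "dunion N M = InL ` N \<union> InR ` M"

definition dunion_arrow :: "'a elt arrow \<Rightarrow> 'a elt arrow \<Rightarrow> 'a elt arrow" where
  "dunion_arrow f g = arr (dunion (Dom f) (Dom g))
     (\<lambda>k. case k of InL i \<Rightarrow> InL (Fun f i) | InR j \<Rightarrow> InR (Fun g j))
     (dunion (Cod f) (Cod g))"

definition \<iota>\<^sub>L :: "'a elt set \<Rightarrow> 'a elt set \<Rightarrow> 'a elt arrow" where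
  "\<iota>\<^sub>L N M = arr N InL (dunion N M)"

definition \<iota>\<^sub>R :: "'a elt set \<Rightarrow> 'a elt set \<Rightarrow> 'a elt arrow" where
  "\<iota>\<^sub>R N M = arr M InR (dunion N M)"

definition FinSet :: "('a elt set, 'a elt arrow) smcat" where
  "FinSet =
    \<lparr>Obj = {N. finite N},
     Hom = arrows,
     Idm = (\<lambda>N. arr N id N),
     Comp = arrow_comp,
     tens = dunion,
     tensm = dunion_arrow,
     unit_obj = {},
     assoc = (\<lambda>N M K. arr (dunion (dunion N M) K)
        (\<lambda>k. case k of InL (InL i) \<Rightarrow> InL i | InL (InR j) \<Rightarrow> InR (InL j) | InR l \<Rightarrow> InR (InR l))
        (dunion N (dunion M K))),
     lunit = (\<lambda>N. arr (dunion {} N) (\<lambda>k. case k of InR i \<Rightarrow> i) N),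
     runit = (\<lambda>N. arr (dunion N {}) (\<lambda>k. case k of InL i \<Rightarrow> i) N),
     braid = (\<lambda>N M. arr (dunion N M) (\<lambda>k. case k of InL i \<Rightarrow> InR i | InR j \<Rightarrow> InL j) (dunion M N))\<rparr>"


section \<open>Sets with Cartesian product\<close>

text \<open>Likewise a universe that contains the (arbitrary) type \<open>'b\<close> and a point, and is closed under
  pairing; the objects are all of its subsets.\<close>

datatype 'b val = Val 'b | Star | VPair "'b val" "'b val"

definition cart :: "'b val set \<Rightarrow> 'b val set \<Rightarrow> 'b val set" where
  "cart A B = {VPair a b | a b. a \<in> A \<and> b \<in> B}"

definition cart_arrow :: "'b val arrow \<Rightarrow> 'b val arrow \<Rightarrow> 'b val arrow" where
  "cart_arrow f g = arr (cart (Dom f) (Dom g))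
     (\<lambda>p. case p of VPair a b \<Rightarrow> VPair (Fun f a) (Fun g b))
     (cart (Cod f) (Cod g))"

definition SetCat :: "('b val set, 'b val arrow) smcat" where
  "SetCat =
    \<lparr>Obj = UNIV,
     Hom = arrows,
     Idm = (\<lambda>A. arr A id A),
     Comp = arrow_comp,
     tens = cart,
     tensm = cart_arrow,
     unit_obj = {Star},
     assoc = (\<lambda>A B C. arr (cart (cart A B) C)
        (\<lambda>p. case p of VPair (VPair a b) c \<Rightarrow> VPair a (VPair b c))
        (cart A (cart B C))),
     lunit = (\<lambda>A. arr (cart {Star} A) (\<lambda>p. case p of VPair s a \<Rightarrow> a) A),
     runit = (\<lambda>A. arr (cart A {Star}) (\<lambda>p. case p of VPair a s \<Rightarrow> a) A),
     braid = (\<lambda>A B. arr (cart A B) (\<lambda>p. case p of VPair a b \<Rightarrow> VPair b a) (cart B A))\<rparr>"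


section \<open>Continuously differentiable functions on \<open>\<real>\<^sup>N\<close>\<close>

definition Rpow :: "'i set \<Rightarrow> ('i \<Rightarrow> real) set" where
  "Rpow N = N \<rightarrow>\<^sub>E UNIV"

text \<open>Frechet differentiability, with the derivative at \<open>x\<close> written in coordinates as
  \<open>h \<mapsto> (\<Sum>i\<in>N. a i * h i)\<close>. The function type \<open>'i \<Rightarrow> real\<close> carries no norm, so
  \<open>has_derivative\<close> is not available; its definition is spelled out here with the Euclidean norm
  of \<open>\<real>\<^sup>N\<close>. The topology of \<open>\<real>\<^sup>N\<close>, whose carrier is \<open>Rpow N\<close>, is \<open>powertop_real N\<close>.\<close>

definition has_gradient_at ::
    "'i set \<Rightarrow> (('i \<Rightarrow> real) \<Rightarrow> real) \<Rightarrow> ('i \<Rightarrow> real) \<Rightarrow> ('i \<Rightarrow> real) \<Rightarrow> bool" where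
  "has_gradient_at N f a x \<longleftrightarrow>
     ((\<lambda>y. (f y - f x - (\<Sum>i\<in>N. a i * (y i - x i))) / L2_set (\<lambda>i. y i - x i) N) \<longlongrightarrow> 0)
       (atin (powertop_real N) x)"

text \<open>The derivative depends continuously on the point: as \<open>N\<close> is finite, this is continuity of
  each of its coordinates.\<close>

definition C1 :: "'i set \<Rightarrow> (('i \<Rightarrow> real) \<Rightarrow> real) \<Rightarrow> bool" where
  "C1 N f \<longleftrightarrow>
     (\<exists>G. (\<forall>x\<in>Rpow N. has_gradient_at N f (G x) x) \<and>
          (\<forall>i\<in>N. continuous_map (powertop_real N) euclideanreal (\<lambda>x. G x i)))"


section \<open>The finset algebra \<open>Opt\<close>\<close>

definition pullback :: "'a elt arrow \<Rightarrow> ('a elt \<Rightarrow> real) \<Rightarrow> ('a elt \<Rightarrow> real)" where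
  "pullback \<phi> y = (\<lambda>i\<in>Dom \<phi>. y (Fun \<phi> i))"

text \<open>The tag \<open>Val\<close> embeds real-valued functions into the universe of \<open>SetCat\<close>. Functions on
  \<open>\<real>\<^sup>N\<close> are \<open>undefined\<close> off \<open>Rpow N\<close>.\<close>

type_synonym 'a optval = "(('a elt \<Rightarrow> real) \<Rightarrow> real) val"

definition Opt :: "'a elt set \<Rightarrow> 'a optval set" where
  "Opt N = Val ` {f \<in> Rpow N \<rightarrow>\<^sub>E UNIV. C1 N f}"

definition Opt_map :: "'a elt arrow \<Rightarrow> 'a optval arrow" where
  "Opt_map \<phi> = arr (Opt (Dom \<phi>))
     (\<lambda>v. case v of Val f \<Rightarrow> Val (\<lambda>y\<in>Rpow (Cod \<phi>). f (pullback \<phi> y)))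
     (Opt (Cod \<phi>))"

definition Opt_prod :: "'a elt set \<Rightarrow> 'a elt set \<Rightarrow> 'a optval arrow" where
  "Opt_prod N M = arr (cart (Opt N) (Opt M))
     (\<lambda>p. case p of VPair (Val f) (Val g) \<Rightarrow>
        Val (\<lambda>z\<in>Rpow (dunion N M). f (pullback (\<iota>\<^sub>L N M) z) + g (pullback (\<iota>\<^sub>R N M) z)))
     (Opt (dunion N M))"

definition Opt_unit :: "'a optval arrow" where
  "Opt_unit = arr {Star} (\<lambda>_. Val (\<lambda>z\<in>Rpow {}. 0)) (Opt {})"

end

theory Submission
  imports Defs
begin

text \<open>The analytic content is that \<open>f \<circ> \<phi>\<^sup>*\<close> and \<open>f \<circ> \<iota>\<^sub>N\<^sup>* + g \<circ> \<iota>\<^sub>M\<^sup>*\<close> are again \<open>C1\<close>. Both follow from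
  closure of \<open>C1\<close> under addition (\<open>C1_add\<close>) and under precomposition with a reindexing map
  \<open>y \<mapsto> (\<lambda>i\<in>N. y (h i))\<close> (\<open>C1_reindex\<close>). A reindexing map is linear, hence its own derivative, and
  Lipschitz; so the remainder quotient of \<open>f \<circ> h\<^sup>*\<close> is at most a constant times that of \<open>f\<close>
  evaluated at \<open>h\<^sup>* y\<close>, and the gradient is carried along by summing over the fibres of \<open>h\<close>.

  The functor and coherence laws are then formal. Every arrow has the form \<open>arr A f B\<close>; on such
  arrows composition, disjoint union, product, \<open>Opt_map\<close> and \<open>Opt_prod\<close> act by explicit formulas, and
  \<open>arr_eq_iff\<close> reduces a law to a pointwise check. The laws of the two categories then
  hold by cases on tags and by taking pairs apart. For \<open>Opt\<close>, both sides of a law evaluate the same functions on the same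
  coordinates, since pullbacks along composable maps compose; what remains is that real addition is
  associative and commutative with neutral element \<open>0\<close>.\<close>

section \<open>Arrows between sets\<close>

lemma Dom_arr [simp]: "Dom (arr A f B) = A"
  and Cod_arr [simp]: "Cod (arr A f B) = B"
  and Fun_arr [simp]: "Fun (arr A f B) = restrict f A"
  by (simp_all add: arr_def)

lemma arr_eq_iff: "arr A f B = arr A' f' B' \<longleftrightarrow> A = A' \<and> B = B' \<and> (\<forall>x\<in>A. f x = f' x)"
  by (auto simp: arr_def fun_eq_iff restrict_def)

lemma arr_in_arrows_iff [simp]: "arr A f B \<in> arrows A' B' \<longleftrightarrow> A = A' \<and> B = B' \<and> f \<in> A \<rightarrow> B"
  by (auto simp: arr_def arrows_def restrict_PiE_iff)

text \<open>The representative \<open>f'\<close> is determined only on \<open>A\<close>; replacing an arrow by this form turns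
  equations between composites into equations between functions.\<close>
lemma arrowsE:
  assumes "f \<in> arrows A B"
  obtains f' where "f = arr A f' B" "f' \<in> A \<rightarrow> B"
proof -
  obtain f' where "f = Arrow A f' B" "f' \<in> A \<rightarrow>\<^sub>E B"
    using assms by (auto simp: arrows_def)
  then have "f = arr A f' B" "f' \<in> A \<rightarrow> B"
    by (auto simp: arr_def PiE_restrict)
  then show ?thesis ..
qed

lemma arrow_comp_arr:
  assumes "f \<in> A \<rightarrow> B"
  shows "arrow_comp (arr B g C) (arr A f B) = arr A (g \<circ> f) C"
  using assms by (auto simp: arrow_comp_def arr_eq_iff)

text \<open>\<open>FinSet\<close> and \<open>SetCat\<close> differ as categories only in their class of objects, so one argument
  for the category axioms and one for isomorphisms serve both.\<close>
lemma category_of_arrows: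
  assumes "Hom C = arrows" "Idm C = (\<lambda>A. arr A id A)" "Comp C = arrow_comp"
  shows "category C"
proof
  fix X Y X' Y' f
  assume "f \<in> Hom C X Y" "f \<in> Hom C X' Y'"
  then show "X = X' \<and> Y = Y'"
    by (auto simp: assms arrows_def)
qed (auto simp: assms arrow_comp_arr arr_eq_iff Pi_iff elim!: arrowsE)

lemma iso_in_arr:
  assumes "Hom C = arrows" "Idm C = (\<lambda>A. arr A id A)" "Comp C = arrow_comp"
    and "f \<in> A \<rightarrow> B" "g \<in> B \<rightarrow> A" "\<And>x. x \<in> A \<Longrightarrow> g (f x) = x" "\<And>y. y \<in> B \<Longrightarrow> f (g y) = y"
  shows "iso_in C A B (arr A f B)"
  unfolding iso_in_def assms(1-3)
proof (intro conjI bexI)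
  show "arr B g A \<in> arrows B A"
    using assms(5) by simp
qed (use assms(4-) in \<open>auto simp: arrow_comp_arr arr_eq_iff\<close>)

section \<open>The two symmetric monoidal categories\<close>

lemma InL_in_dunion [simp]: "InL i \<in> dunion N M \<longleftrightarrow> i \<in> N"
  and InR_in_dunion [simp]: "InR j \<in> dunion N M \<longleftrightarrow> j \<in> M"
  and finite_dunion [simp]: "finite (dunion N M) \<longleftrightarrow> finite N \<and> finite M"
  by (auto simp: dunion_def finite_image_iff inj_on_def)

lemma ball_dunion [simp]:
  "(\<forall>k\<in>dunion N M. P k) \<longleftrightarrow> (\<forall>i\<in>N. P (InL i)) \<and> (\<forall>j\<in>M. P (InR j))"
  by (auto simp: dunion_def)

text \<open>The tensor product of arrows does not see the restriction that \<open>arr\<close> imposes on its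
  factors. With this rule, and its analogue for products, \<open>f\<close> and \<open>g\<close> appear without domain guards in
  the pointwise form of the monoidal laws.\<close>
lemma dunion_arrow_arr:
  "dunion_arrow (arr N f N') (arr M g M') =
    arr (dunion N M) (\<lambda>k. case k of InL i \<Rightarrow> InL (f i) | InR j \<Rightarrow> InR (g j)) (dunion N' M')"
  by (simp add: dunion_arrow_def arr_eq_iff)

lemma VPair_in_cart [simp]: "VPair a b \<in> cart A B \<longleftrightarrow> a \<in> A \<and> b \<in> B"
  by (simp add: cart_def)

lemma ball_cart [simp]: "(\<forall>p\<in>cart A B. P p) \<longleftrightarrow> (\<forall>a\<in>A. \<forall>b\<in>B. P (VPair a b))"
  by (auto simp: cart_def)

lemma cart_arrow_arr:
  "cart_arrow (arr A f A') (arr B g B') =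
    arr (cart A B) (\<lambda>p. case p of VPair a b \<Rightarrow> VPair (f a) (g b)) (cart A' B')"
  by (simp add: cart_arrow_def arr_eq_iff)

lemma symmetric_monoidal_FinSet:
  "symmetric_monoidal_category (FinSet :: ('a elt set, 'a elt arrow) smcat)"
proof -
  interpret category "FinSet :: ('a elt set, 'a elt arrow) smcat"
    by (rule category_of_arrows) (simp_all add: FinSet_def)
  show ?thesis
  proof
    fix X Y Z :: "'a elt set"
    show "iso_in FinSet ((X \<otimes>\<^bsub>FinSet\<^esub> Y) \<otimes>\<^bsub>FinSet\<^esub> Z) (X \<otimes>\<^bsub>FinSet\<^esub> Y \<otimes>\<^bsub>FinSet\<^esub> Z) (\<alpha>\<^bsub>FinSet\<^esub> X Y Z)"
      unfolding FinSet_def smcat.simps cat.simps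
      by (rule iso_in_arr[where g = "\<lambda>k. case k of InL i \<Rightarrow> InL (InL i)
          | InR (InL j) \<Rightarrow> InL (InR j) | InR (InR l) \<Rightarrow> InR l"]) (auto simp: dunion_def)
    show "iso_in FinSet (\<one>\<^bsub>FinSet\<^esub> \<otimes>\<^bsub>FinSet\<^esub> X) X (\<lambda>l\<^bsub>FinSet\<^esub> X)"
      unfolding FinSet_def smcat.simps cat.simps
      by (rule iso_in_arr[where g = InR]) (auto simp: dunion_def)
    show "iso_in FinSet (X \<otimes>\<^bsub>FinSet\<^esub> \<one>\<^bsub>FinSet\<^esub>) X (\<rho>\<^bsub>FinSet\<^esub> X)"
      unfolding FinSet_def smcat.simps cat.simps
      by (rule iso_in_arr[where g = InL]) (auto simp: dunion_def)
    show "iso_in FinSet (X \<otimes>\<^bsub>FinSet\<^esub> Y) (Y \<otimes>\<^bsub>FinSet\<^esub> X) (\<sigma>\<^bsub>FinSet\<^esub> X Y)"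
      unfolding FinSet_def smcat.simps cat.simps
      by (rule iso_in_arr[where g = "\<lambda>k. case k of InL i \<Rightarrow> InR i | InR j \<Rightarrow> InL j"])
        (auto simp: dunion_def)
  qed (auto simp: FinSet_def dunion_arrow_arr arrow_comp_arr arr_eq_iff Pi_iff elim!: arrowsE)
qed

lemma symmetric_monoidal_SetCat:
  "symmetric_monoidal_category (SetCat :: ('b val set, 'b val arrow) smcat)"
proof -
  interpret category "SetCat :: ('b val set, 'b val arrow) smcat"
    by (rule category_of_arrows) (simp_all add: SetCat_def)
  show ?thesis
  proof
    fix X Y Z :: "'b val set"
    show "iso_in SetCat ((X \<otimes>\<^bsub>SetCat\<^esub> Y) \<otimes>\<^bsub>SetCat\<^esub> Z) (X \<otimes>\<^bsub>SetCat\<^esub> Y \<otimes>\<^bsub>SetCat\<^esub> Z) (\<alpha>\<^bsub>SetCat\<^esub> X Y Z)"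
      unfolding SetCat_def smcat.simps cat.simps
      by (rule iso_in_arr[where g = "\<lambda>p. case p of VPair a (VPair b c) \<Rightarrow> VPair (VPair a b) c"])
        (auto simp: cart_def)
    show "iso_in SetCat (\<one>\<^bsub>SetCat\<^esub> \<otimes>\<^bsub>SetCat\<^esub> X) X (\<lambda>l\<^bsub>SetCat\<^esub> X)"
      unfolding SetCat_def smcat.simps cat.simps
      by (rule iso_in_arr[where g = "VPair Star"]) (auto simp: cart_def)
    show "iso_in SetCat (X \<otimes>\<^bsub>SetCat\<^esub> \<one>\<^bsub>SetCat\<^esub>) X (\<rho>\<^bsub>SetCat\<^esub> X)"
      unfolding SetCat_def smcat.simps cat.simps
      by (rule iso_in_arr[where g = "\<lambda>a. VPair a Star"]) (auto simp: cart_def)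
    show "iso_in SetCat (X \<otimes>\<^bsub>SetCat\<^esub> Y) (Y \<otimes>\<^bsub>SetCat\<^esub> X) (\<sigma>\<^bsub>SetCat\<^esub> X Y)"
      unfolding SetCat_def smcat.simps cat.simps
      by (rule iso_in_arr[where g = "\<lambda>p. case p of VPair a b \<Rightarrow> VPair b a"])
        (auto simp: cart_def)
  qed (auto simp: SetCat_def cart_arrow_arr arrow_comp_arr arr_eq_iff Pi_iff elim!: arrowsE)
qed

section \<open>Continuously differentiable functions\<close>

text \<open>The remainder quotient in the definition of the gradient is \<open>0 / 0 = 0\<close> at the base point,
  which is also its limit. Hence the punctured limit may be replaced by a full one. The full
  limit is the one that can be composed with a continuous map that is not injective, such as a
  reindexing map: that map may send points other than \<open>x\<close> to the image of \<open>x\<close>.\<close>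
lemma tendsto_atin_iff_nhdsin:
  assumes "q x = l"
  shows "(q \<longlongrightarrow> l) (atin X x) \<longleftrightarrow> (q \<longlongrightarrow> l) (nhdsin X x)"
  unfolding tendsto_def eventually_atin eventually_nhdsin
  using assms by (metis Diff_iff Diff_empty insertE insert_iff)

lemma filterlim_nhdsin_continuous_map:
  assumes "continuous_map X Y p" "x \<in> topspace X"
  shows "filterlim p (nhdsin Y (p x)) (nhdsin X x)"
  unfolding filterlim_iff eventually_nhdsin
proof (intro allI impI)
  fix P
  assume "p x \<notin> topspace Y \<or> (\<exists>S. openin Y S \<and> p x \<in> S \<and> (\<forall>y\<in>S. P y))"
  then obtain S where S: "openin Y S" "p x \<in> S" "\<forall>y\<in>S. P y"
    using assms by (auto simp: continuous_map_def)
  then have "openin X {y \<in> topspace X. p y \<in> S}"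
    using assms(1) openin_continuous_map_preimage by blast
  then show "x \<notin> topspace X \<or> (\<exists>S. openin X S \<and> x \<in> S \<and> (\<forall>y\<in>S. P (p y)))"
    using S assms(2) by blast
qed

lemma topspace_powertop_real: "topspace (powertop_real N) = Rpow N"
  by (simp add: Rpow_def)

definition remainder_quotient ::
    "'i set \<Rightarrow> (('i \<Rightarrow> real) \<Rightarrow> real) \<Rightarrow> ('i \<Rightarrow> real) \<Rightarrow> ('i \<Rightarrow> real) \<Rightarrow> ('i \<Rightarrow> real) \<Rightarrow> real" where
  "remainder_quotient N f a x y =
     (f y - f x - (\<Sum>i\<in>N. a i * (y i - x i))) / L2_set (\<lambda>i. y i - x i) N"

lemma has_gradient_at_iff_nhdsin:
  "has_gradient_at N f a x \<longleftrightarrow> (remainder_quotient N f a x \<longlongrightarrow> 0) (nhdsin (powertop_real N) x)"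
  unfolding has_gradient_at_def remainder_quotient_def
  by (rule tendsto_atin_iff_nhdsin) simp

text \<open>\<open>Rpow N\<close> is the whole space of \<open>powertop_real N\<close>, so it is a neighbourhood of \<open>x\<close>. This permits
  passing between a formula and its restriction, the form in which elements of \<open>Opt N\<close> are
  stored.\<close>
lemma has_gradient_at_cong:
  assumes "\<And>y. y \<in> Rpow N \<Longrightarrow> f y = g y" "x \<in> Rpow N" "has_gradient_at N f a x"
  shows "has_gradient_at N g a x"
proof -
  have "\<forall>\<^sub>F y in nhdsin (powertop_real N) x. remainder_quotient N f a x y = remainder_quotient N g a x y"
    unfolding eventually_nhdsin
    using openin_topspace[of "powertop_real N", unfolded topspace_powertop_real] assms(1,2)
    by (intro disjI2 exI[of _ "Rpow N"]) (simp add: remainder_quotient_def)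
  then show ?thesis
    using assms(3) tendsto_cong unfolding has_gradient_at_iff_nhdsin by blast
qed

lemma C1_cong:
  assumes "\<And>y. y \<in> Rpow N \<Longrightarrow> f y = g y" "C1 N f"
  shows "C1 N g"
  using assms has_gradient_at_cong[of N f g] unfolding C1_def by blast

lemma C1_const: "C1 N (\<lambda>_. c)"
  unfolding C1_def has_gradient_at_def by (intro exI[of _ "\<lambda>_ _. 0"]) simp

lemma has_gradient_at_add:
  assumes "has_gradient_at N f a x" "has_gradient_at N g b x"
  shows "has_gradient_at N (\<lambda>y. f y + g y) (\<lambda>i. a i + b i) x"
proof -
  have "remainder_quotient N (\<lambda>y. f y + g y) (\<lambda>i. a i + b i) x =
      (\<lambda>y. remainder_quotient N f a x y + remainder_quotient N g b x y)"
    by (simp add: remainder_quotient_def fun_eq_iff sum.distrib distrib_right diff_divide_distrib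
        add_divide_distrib)
  then show ?thesis
    using tendsto_add[OF assms[unfolded has_gradient_at_iff_nhdsin]]
    by (simp add: has_gradient_at_iff_nhdsin)
qed

lemma C1_add:
  assumes "C1 N f" "C1 N g"
  shows "C1 N (\<lambda>y. f y + g y)"
proof -
  obtain F G where "\<forall>x\<in>Rpow N. has_gradient_at N f (F x) x"
      "\<forall>i\<in>N. continuous_map (powertop_real N) euclideanreal (\<lambda>x. F x i)"
      "\<forall>x\<in>Rpow N. has_gradient_at N g (G x) x"
      "\<forall>i\<in>N. continuous_map (powertop_real N) euclideanreal (\<lambda>x. G x i)"
    using assms unfolding C1_def by blast
  then show ?thesis
    unfolding C1_def
    by (intro exI[of _ "\<lambda>x i. F x i + G x i"])
      (auto intro: has_gradient_at_add continuous_map_add)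
qed

lemma continuous_map_reindex:
  assumes "h \<in> N \<rightarrow> M"
  shows "continuous_map (powertop_real M) (powertop_real N) (\<lambda>y. \<lambda>i\<in>N. y (h i))"
  using assms
  by (auto simp: continuous_map_componentwise intro!: continuous_map_product_projection)

text \<open>Reindexing is Lipschitz. The constant \<open>card N\<close> is crude but avoids square roots: the
  Euclidean norm is at most the sum of the absolute values of the coordinates, each of which is a
  coordinate of \<open>u\<close>.\<close>
lemma L2_set_reindex_le:
  assumes "finite M" "h \<in> N \<rightarrow> M"
  shows "L2_set (\<lambda>i. u (h i)) N \<le> real (card N) * L2_set u M"
proof -
  have "L2_set (\<lambda>i. u (h i)) N \<le> (\<Sum>i\<in>N. \<bar>u (h i)\<bar>)"
    by (rule L2_set_le_sum_abs)
  also have "\<dots> \<le> (\<Sum>i\<in>N. L2_set u M)"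
  proof (rule sum_mono)
    fix i assume "i \<in> N"
    then have "\<bar>u (h i)\<bar> \<le> L2_set (\<lambda>j. \<bar>u j\<bar>) M"
      using assms member_le_L2_set[of M "h i" "\<lambda>j. \<bar>u j\<bar>"] by auto
    then show "\<bar>u (h i)\<bar> \<le> L2_set u M"
      by (simp add: L2_set_def)
  qed
  finally show ?thesis by simp
qed

text \<open>The chain rule for reindexing. As \<open>x j\<close> feeds all coordinates \<open>i\<close> with \<open>h i = j\<close>, the partial
  derivative in direction \<open>j\<close> is the sum of the partial derivatives of \<open>f\<close> over that fibre. Then
  both remainders have the same numerator, and the Lipschitz bound compares the
  denominators.\<close>
lemma has_gradient_at_reindex:
  fixes h :: "'i \<Rightarrow> 'j"
  assumes fin: "finite N" "finite M" and h: "h \<in> N \<rightarrow> M" and x: "x \<in> Rpow M"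
    and grad: "has_gradient_at N f a (\<lambda>i\<in>N. x (h i))"
  shows "has_gradient_at M (\<lambda>y. f (\<lambda>i\<in>N. y (h i))) (\<lambda>j. \<Sum>i\<in>{i\<in>N. h i = j}. a i) x"
proof -
  define p :: "('j \<Rightarrow> real) \<Rightarrow> 'i \<Rightarrow> real" where "p y = (\<lambda>i\<in>N. y (h i))" for y
  let ?b = "\<lambda>j. \<Sum>i\<in>{i\<in>N. h i = j}. a i"
  let ?q = "remainder_quotient N f a (p x)"
  have sum_eq: "(\<Sum>j\<in>M. ?b j * (y j - x j)) = (\<Sum>i\<in>N. a i * (p y i - p x i))" for y
  proof -
    have "(\<Sum>j\<in>M. ?b j * (y j - x j)) = (\<Sum>j\<in>M. \<Sum>i\<in>{i\<in>N. h i = j}. a i * (y (h i) - x (h i)))"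
      by (simp add: sum_distrib_right)
    also have "\<dots> = (\<Sum>i\<in>N. a i * (y (h i) - x (h i)))"
      using fin h by (intro sum.group) auto
    finally show ?thesis by (simp add: p_def)
  qed
  have le: "norm (remainder_quotient M (\<lambda>y. f (p y)) ?b x y) \<le> real (card N) * \<bar>?q (p y)\<bar>" for y
  proof -
    define A where "A = f (p y) - f (p x) - (\<Sum>i\<in>N. a i * (p y i - p x i))"
    define K where "K = L2_set (\<lambda>j. y j - x j) M"
    define L where "L = L2_set (\<lambda>i. p y i - p x i) N"
    have "L = L2_set (\<lambda>i. y (h i) - x (h i)) N"
      unfolding L_def p_def by (rule L2_set_cong) auto
    then have LK: "L \<le> real (card N) * K"
      using L2_set_reindex_le[OF fin(2) h, of "\<lambda>j. y j - x j"] by (simp add: K_def)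
    have nonneg: "0 \<le> L" "0 \<le> K" by (simp_all add: L_def K_def)
    have "\<bar>A\<bar> / K \<le> real (card N) * (\<bar>A\<bar> / L)"
    proof (cases "L = 0")
      case True
      \<comment> \<open>The right-hand side is \<open>0\<close> by division by zero, so the common numerator has to vanish.\<close>
      then have "p y = p x"
        using fin by (auto simp: L_def L2_set_eq_0_iff p_def fun_eq_iff restrict_def)
      then show ?thesis by (simp add: A_def)
    next
      case False
      then have "L > 0" "K > 0" using nonneg LK by (auto intro: le_neq_trans)
      then show ?thesis
        using mult_left_mono[OF LK, of "\<bar>A\<bar>"] by (simp add: field_simps)
    qed
    then show ?thesis
      using nonneg
      by (simp add: remainder_quotient_def sum_eq A_def[symmetric] K_def[symmetric] L_def[symmetric])
  qed
  \<comment> \<open>As \<open>h\<close> need not be surjective, \<open>p\<close> does not respect punctured neighbourhoods.\<close>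
  have "filterlim p (nhdsin (powertop_real N) (p x)) (nhdsin (powertop_real M) x)"
    unfolding p_def
    by (rule filterlim_nhdsin_continuous_map[OF continuous_map_reindex[OF h]])
      (use x in \<open>simp add: Rpow_def\<close>)
  with grad have "((\<lambda>y. ?q (p y)) \<longlongrightarrow> 0) (nhdsin (powertop_real M) x)"
    unfolding has_gradient_at_iff_nhdsin p_def[symmetric] by (rule filterlim_compose)
  then have "((\<lambda>y. real (card N) * \<bar>?q (p y)\<bar>) \<longlongrightarrow> 0) (nhdsin (powertop_real M) x)"
    by (intro tendsto_mult_right_zero tendsto_rabs_zero)
  then have "(remainder_quotient M (\<lambda>y. f (p y)) ?b x \<longlongrightarrow> 0) (nhdsin (powertop_real M) x)"
    by (rule Lim_null_comparison[rotated]) (intro always_eventually allI le)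
  then show ?thesis
    by (simp add: has_gradient_at_iff_nhdsin p_def)
qed

lemma C1_reindex:
  assumes "finite N" "finite M" "h \<in> N \<rightarrow> M" "C1 N f"
  shows "C1 M (\<lambda>y. f (\<lambda>i\<in>N. y (h i)))"
proof -
  obtain G where grad: "\<forall>x\<in>Rpow N. has_gradient_at N f (G x) x"
      and cont: "\<forall>i\<in>N. continuous_map (powertop_real N) euclideanreal (\<lambda>x. G x i)"
    using assms(4) unfolding C1_def by blast
  show ?thesis
    unfolding C1_def
  proof (intro exI conjI ballI)
    fix x :: "'b \<Rightarrow> real" assume "x \<in> Rpow M"
    moreover have "(\<lambda>i\<in>N. x (h i)) \<in> Rpow N" by (simp add: Rpow_def)
    ultimately show "has_gradient_at M (\<lambda>y. f (\<lambda>i\<in>N. y (h i)))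
        (\<lambda>j. \<Sum>i\<in>{i\<in>N. h i = j}. G (\<lambda>i\<in>N. x (h i)) i) x"
      using assms(1-3) grad by (intro has_gradient_at_reindex) blast+
  next
    fix j
    show "continuous_map (powertop_real M) euclideanreal
        (\<lambda>x. \<Sum>i\<in>{i\<in>N. h i = j}. G (\<lambda>i\<in>N. x (h i)) i)"
      using assms(1) cont continuous_map_compose[OF continuous_map_reindex[OF assms(3)]]
      by (intro continuous_map_sum) (auto simp: o_def)
  qed
qed

section \<open>Opt as a lax symmetric monoidal functor\<close>

lemma pullback_arr: "pullback (arr N h M) y = (\<lambda>i\<in>N. y (h i))"
  by (simp add: pullback_def cong: restrict_cong)

lemma restrict_in_Rpow [simp]: "restrict y N \<in> Rpow N"
  by (simp add: Rpow_def)

lemma restrict_Rpow: "y \<in> Rpow N \<Longrightarrow> restrict y N = y"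
  by (simp add: Rpow_def PiE_restrict)

lemma restrict_eq_restrict_iff: "restrict f A = restrict g A \<longleftrightarrow> (\<forall>x\<in>A. f x = g x)"
  by (auto simp: fun_eq_iff restrict_def)

lemma Val_in_Opt [simp]: "Val f \<in> Opt N \<longleftrightarrow> f \<in> extensional (Rpow N) \<and> C1 N f"
  by (auto simp: Opt_def PiE_def)

lemma ball_Opt [simp]:
  "(\<forall>v\<in>Opt N. P v) \<longleftrightarrow> (\<forall>f. f \<in> extensional (Rpow N) \<and> C1 N f \<longrightarrow> P (Val f))"
  by (auto simp: Opt_def PiE_def)

lemma Opt_map_arr:
  "Opt_map (arr N h M) =
    arr (Opt N) (\<lambda>v. case v of Val f \<Rightarrow> Val (\<lambda>y\<in>Rpow M. f (\<lambda>i\<in>N. y (h i)))) (Opt M)"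
  by (simp add: Opt_map_def pullback_arr arr_eq_iff)

lemma Opt_prod_arr:
  "Opt_prod N M =
    arr (cart (Opt N) (Opt M))
      (\<lambda>p. case p of VPair (Val f) (Val g) \<Rightarrow>
         Val (\<lambda>z\<in>Rpow (dunion N M). f (\<lambda>i\<in>N. z (InL i)) + g (\<lambda>j\<in>M. z (InR j))))
      (Opt (dunion N M))"
  by (simp add: Opt_prod_def \<iota>\<^sub>L_def \<iota>\<^sub>R_def pullback_arr arr_eq_iff)

text \<open>Elements of \<open>Opt N\<close> are restricted to \<open>Rpow N\<close>, whereas \<open>C1_add\<close> and \<open>C1_reindex\<close> speak of
  unrestricted formulas; this lemma strips the restriction.\<close>
lemma C1_restrict_iff: "C1 N (restrict f (Rpow N)) \<longleftrightarrow> C1 N f"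
  using C1_cong[of N "restrict f (Rpow N)" f] C1_cong[of N f "restrict f (Rpow N)"] by auto

lemma Opt_map_in_arrows:
  assumes "finite N" "finite M" "\<phi> \<in> arrows N M"
  shows "Opt_map \<phi> \<in> arrows (Opt N) (Opt M)"
proof -
  obtain h where "\<phi> = arr N h M" "h \<in> N \<rightarrow> M"
    using assms(3) by (rule arrowsE)
  then show ?thesis
    using assms by (simp add: Opt_map_arr Pi_iff C1_restrict_iff C1_reindex)
qed

lemma Opt_prod_in_arrows:
  assumes "finite N" "finite M"
  shows "Opt_prod N M \<in> arrows (cart (Opt N) (Opt M)) (Opt (dunion N M))"
  using assms by (simp add: Opt_prod_arr Pi_iff C1_restrict_iff C1_add C1_reindex)

lemma Opt_unit_in_arrows: "Opt_unit \<in> arrows {Star} (Opt {})"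
  by (simp add: Opt_unit_def Pi_iff C1_restrict_iff C1_const)

theorem lemma3p1:
  shows "lax_symmetric_monoidal_functor
           (FinSet :: ('a elt set, 'a elt arrow) smcat) SetCat Opt Opt_map Opt_prod Opt_unit"
proof -
  interpret C: symmetric_monoidal_category "FinSet :: ('a elt set, 'a elt arrow) smcat"
    by (rule symmetric_monoidal_FinSet)
  interpret D: symmetric_monoidal_category "SetCat :: ('a optval set, 'a optval arrow) smcat"
    by (rule symmetric_monoidal_SetCat)
  note [simp] = FinSet_def SetCat_def
  note arr_simps = arrow_comp_arr arr_eq_iff Pi_iff dunion_arrow_arr cart_arrow_arr
    Opt_map_arr Opt_prod_arr restrict_eq_restrict_iff C1_restrict_iff C1_reindex C1_add
  show ?thesis
  proof
    fix X :: "'a elt set"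
    show "X \<in> Obj FinSet \<Longrightarrow> Opt_map (Idm FinSet X) = Idm SetCat (Opt X)"
      by (simp add: arr_simps restrict_Rpow extensional_restrict cong: restrict_cong)
  next
    fix X Y Z :: "'a elt set" and f g
    assume "X \<in> Obj FinSet" "Y \<in> Obj FinSet" "Z \<in> Obj FinSet"
      "f \<in> Hom FinSet X Y" "g \<in> Hom FinSet Y Z"
    then show "Opt_map (g \<odot>\<^bsub>FinSet\<^esub> f) = Opt_map g \<odot>\<^bsub>SetCat\<^esub> Opt_map f"
      by (auto simp: arr_simps elim!: arrowsE cong: restrict_cong)
  next
    fix X Y X' Y' :: "'a elt set" and f g
    assume "X \<in> Obj FinSet" "Y \<in> Obj FinSet" "X' \<in> Obj FinSet" "Y' \<in> Obj FinSet"
      "f \<in> Hom FinSet X X'" "g \<in> Hom FinSet Y Y'"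
    then show "Opt_prod X' Y' \<odot>\<^bsub>SetCat\<^esub> (Opt_map f \<boxtimes>\<^bsub>SetCat\<^esub> Opt_map g)
        = Opt_map (f \<boxtimes>\<^bsub>FinSet\<^esub> g) \<odot>\<^bsub>SetCat\<^esub> Opt_prod X Y"
      by (auto simp: arr_simps elim!: arrowsE cong: restrict_cong)
  next
    fix X Y Z :: "'a elt set"
    assume "X \<in> Obj FinSet" "Y \<in> Obj FinSet" "Z \<in> Obj FinSet"
    then show "Opt_map (\<alpha>\<^bsub>FinSet\<^esub> X Y Z) \<odot>\<^bsub>SetCat\<^esub> Opt_prod (X \<otimes>\<^bsub>FinSet\<^esub> Y) Z
          \<odot>\<^bsub>SetCat\<^esub> (Opt_prod X Y \<boxtimes>\<^bsub>SetCat\<^esub> Idm SetCat (Opt Z))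
        = Opt_prod X (Y \<otimes>\<^bsub>FinSet\<^esub> Z) \<odot>\<^bsub>SetCat\<^esub> (Idm SetCat (Opt X) \<boxtimes>\<^bsub>SetCat\<^esub> Opt_prod Y Z)
          \<odot>\<^bsub>SetCat\<^esub> \<alpha>\<^bsub>SetCat\<^esub> (Opt X) (Opt Y) (Opt Z)"
      by (simp add: arr_simps add.assoc cong: restrict_cong)
  next
    fix X :: "'a elt set"
    assume "X \<in> Obj FinSet"
    then show "Opt_map (\<lambda>l\<^bsub>FinSet\<^esub> X) \<odot>\<^bsub>SetCat\<^esub> Opt_prod \<one>\<^bsub>FinSet\<^esub> X
        \<odot>\<^bsub>SetCat\<^esub> (Opt_unit \<boxtimes>\<^bsub>SetCat\<^esub> Idm SetCat (Opt X)) = \<lambda>l\<^bsub>SetCat\<^esub> (Opt X)"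
      by (simp add: arr_simps Opt_unit_def C1_const restrict_Rpow extensional_restrict
          cong: restrict_cong)
  next
    fix X :: "'a elt set"
    assume "X \<in> Obj FinSet"
    then show "Opt_map (\<rho>\<^bsub>FinSet\<^esub> X) \<odot>\<^bsub>SetCat\<^esub> Opt_prod X \<one>\<^bsub>FinSet\<^esub>
        \<odot>\<^bsub>SetCat\<^esub> (Idm SetCat (Opt X) \<boxtimes>\<^bsub>SetCat\<^esub> Opt_unit) = \<rho>\<^bsub>SetCat\<^esub> (Opt X)"
      by (simp add: arr_simps Opt_unit_def C1_const restrict_Rpow extensional_restrict
          cong: restrict_cong)
  next
    fix X Y :: "'a elt set"
    assume "X \<in> Obj FinSet" "Y \<in> Obj FinSet"
    then show "Opt_map (\<sigma>\<^bsub>FinSet\<^esub> X Y) \<odot>\<^bsub>SetCat\<^esub> Opt_prod X Y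
        = Opt_prod Y X \<odot>\<^bsub>SetCat\<^esub> \<sigma>\<^bsub>SetCat\<^esub> (Opt X) (Opt Y)"
      by (simp add: arr_simps add.commute cong: restrict_cong)
  qed (simp_all add: Opt_map_in_arrows Opt_prod_in_arrows Opt_unit_in_arrows)
qed

end
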